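(* Let $n\ge 1$ be an integer. The number $\alpha_0$ of distinct permutations, with no matches, of the multiset consisting of four copies of each integer $1,\dots,n$ is $$\alpha_0=\sum_{s+t+u+v+w=n}(-1)^{t+w}\binom{n}{s,t,u,v,w}\frac{(4s+3t+2u+2v+w)!}{(4!)^s(2!)^t(2!)^v},$$ where the sum is over all nonnegative integers $s,t,u,v,w$ with $s+t+u+v+w=n$.
   Context: A permutation of the multiset is a sequence $(a_1,\dots,a_{4n})$ in which each of $1,\dots,n$ appears exactly four times. It has no matches if $a_i\ne a_{i+1}$ for all $1\le i\le 4n-1$. $\binom{n}{s,t,u,v,w}=\frac{n!}{s!\,t!\,u!\,v!\,w!}$ is the multinomial coefficient. *)

theory Defs
  imports Complex_Main "HOL-Combinatorics.Multiset_Permutations"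
begin

definition four_copies :: "nat \<Rightarrow> nat multiset" where
  "four_copies n = repeat_mset 4 (mset_set {1..n})"

lemma count_four_copies: "count (four_copies n) k = (if k \<in> {1..n} then 4 else 0)"
  by (simp add: four_copies_def)

lemma size_four_copies: "size (four_copies n) = 4 * n"
  by (simp add: four_copies_def)

(* distinct_adj xs says that xs ! i and xs ! Suc i differ for all i with Suc i < length xs
   (distinct_adj_conv_nth), i.e. that xs has no matches. *)
definition alpha0 :: "nat \<Rightarrow> nat" where
  "alpha0 n = card {xs \<in> permutations_of_multiset (four_copies n). distinct_adj xs}"

definition weak_compositions5 :: "nat \<Rightarrow> (nat \<times> nat \<times> nat \<times> nat \<times> nat) set" where
  "weak_compositions5 n = {(s, t, u, v, w). s + t + u + v + w = n}"

lemma finite_weak_compositions5: "finite (weak_compositions5 n)"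
proof (rule finite_subset)
  show "weak_compositions5 n \<subseteq> {..n} \<times> {..n} \<times> {..n} \<times> {..n} \<times> {..n}"
    by (auto simp: weak_compositions5_def)
qed simp

definition multinomial5 :: "nat \<Rightarrow> nat \<Rightarrow> nat \<Rightarrow> nat \<Rightarrow> nat \<Rightarrow> nat \<Rightarrow> real" where
  "multinomial5 n s t u v w = fact n / (fact s * fact t * fact u * fact v * fact w)"

end

theory Submission
  imports Defs "HOL-Computational_Algebra.Polynomial"
begin

text \<open>
  Words without equal adjacent letters (Smirnov words) can be counted for any prescribed letter
  multiplicities \<open>m\<^sub>a\<close>. Cut each letter's \<open>m\<^sub>a\<close> copies into a sequence of \<open>j\<^sub>a\<close> nonempty
  blocks, glue each block together, arrange all the blocks, and give the result the sign
  \<open>(-1) ^ (\<Sum>a. m\<^sub>a - j\<^sub>a)\<close>. Inclusion-exclusion over the glued positions leaves exactly the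
  Smirnov words. There are \<open>(m - 1) choose (j - 1)\<close> ways to cut \<open>m\<close> copies into \<open>j\<close> blocks, and
  \<open>(\<Sum>a. j\<^sub>a)! / (\<Prod>a. j\<^sub>a!)\<close> ways to arrange the blocks. Hence the count is \<open>L (\<Prod>a. q\<^sub>m\<^sub>a)\<close>,
  where \<open>q\<^sub>m = (\<Sum>j. (-1) ^ (m - j) * ((m - 1) choose (j - 1)) * X ^ j / j!)\<close> and \<open>L\<close> is the linear
  functional on polynomials that sends \<open>X ^ j\<close> to \<open>j!\<close>.

  The proof replaces the inclusion-exclusion by a recursion on the first letter. Since \<open>L p\<close> is the
  integral of \<open>p x * exp (-x)\<close> over \<open>x \<ge> 0\<close>, integration by parts gives \<open>L p' = L p - p 0\<close>
  (\<open>factorial_functional_pderiv\<close>). The polynomials satisfy \<open>q\<^sub>m\<^sub>+\<^sub>1' = q\<^sub>m - q\<^sub>m'\<close>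
  (\<open>pderiv_run_poly_Suc\<close>), which mirrors the rule that a Smirnov word starting with \<open>a\<close> is \<open>a\<close>
  followed by a Smirnov word that does not start with \<open>a\<close>. So differentiating the factor of \<open>a\<close>
  in the product selects the words that start with \<open>a\<close>, and the product rule adds these up over
  all \<open>a\<close>; this is \<open>card_smirnov_words\<close>.

  For four copies of each of \<open>n\<close> letters the count is \<open>L (q\<^sub>4 ^ n)\<close> with
  \<open>q\<^sub>4 = X^4 / 4! - X^3 / 2! + X^2 + X^2 / 2! - X\<close>. The two quadratic terms stand for the cuts of type
  \<open>1 + 3\<close> and \<open>2 + 2\<close>. Keeping them apart, the multinomial theorem with five summands yields the
  claimed sum.
\<close>

section \<open>The functional sending each power to a factorial\<close>

definition factorial_functional :: "real poly \<Rightarrow> real" where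
  "factorial_functional p = (\<Sum>j\<le>degree p. coeff p j * fact j)"

lemma factorial_functional_bound:
  assumes "degree p \<le> N"
  shows "factorial_functional p = (\<Sum>j\<le>N. coeff p j * fact j)"
  unfolding factorial_functional_def
  by (rule sum.mono_neutral_left) (use assms in \<open>auto simp: coeff_eq_0\<close>)

lemma factorial_functional_0 [simp]: "factorial_functional 0 = 0"
  by (simp add: factorial_functional_def)

lemma factorial_functional_add:
  "factorial_functional (p + q) = factorial_functional p + factorial_functional q"
proof -
  define N where "N = max (degree p) (degree q)"
  have "degree (p + q) \<le> N" "degree p \<le> N" "degree q \<le> N"
    by (auto simp: N_def degree_add_le)
  then show ?thesis
    by (simp add: factorial_functional_bound sum.distrib algebra_simps)
qed

lemma factorial_functional_smult:
  "factorial_functional (smult c p) = c * factorial_functional p"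
  by (subst factorial_functional_bound[of _ "degree p"])
    (simp_all add: factorial_functional_def sum_distrib_left mult.assoc)

lemma factorial_functional_diff:
  "factorial_functional (p - q) = factorial_functional p - factorial_functional q"
  using factorial_functional_add[of p "smult (-1) q"]
    factorial_functional_smult[of "-1" q] by simp

lemma factorial_functional_sum:
  "factorial_functional (sum f A) = (\<Sum>x\<in>A. factorial_functional (f x))"
proof (cases "finite A")
  case True
  then show ?thesis
    by induction (simp_all add: factorial_functional_add)
qed simp

lemma factorial_functional_monom: "factorial_functional (monom c j) = c * fact j"
proof -
  have "factorial_functional (monom c j) = (\<Sum>i\<le>j. if i = j then c * fact j else 0)"
    unfolding factorial_functional_bound[OF degree_monom_le] by (rule sum.cong) auto
  then show ?thesis by simp
qed

text \<open>
  This is integration by parts for the integral of \<open>p x * exp (-x)\<close> over the positive half-line; on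
  the power \<open>X ^ Suc j\<close> it is just \<open>fact (Suc j) = Suc j * fact j\<close>.
\<close>

lemma factorial_functional_pderiv:
  "factorial_functional (pderiv p) = factorial_functional p - coeff p 0"
proof -
  have "factorial_functional p = (\<Sum>j\<le>Suc (degree p). coeff p j * fact j)"
    by (rule factorial_functional_bound) simp
  also have "\<dots> = coeff p 0 + (\<Sum>j\<le>degree p. coeff p (Suc j) * fact (Suc j))"
    by (subst sum.atMost_Suc_shift) simp
  also have "(\<Sum>j\<le>degree p. coeff p (Suc j) * fact (Suc j)) = factorial_functional (pderiv p)"
    by (subst factorial_functional_bound[of _ "degree p"])
      (auto simp: degree_pderiv coeff_pderiv algebra_simps intro!: sum.cong)
  finally show ?thesis by simp
qed

section \<open>The polynomial of a single letter\<close>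

text \<open>
  The coefficient of \<open>X ^ j\<close> is the signed number of compositions of \<open>m\<close> into \<open>j\<close> parts, divided by
  \<open>j!\<close>. Up to the sign \<open>(-1) ^ m\<close> these are the generalized Laguerre polynomials with parameter
  \<open>-1\<close>. Adding instead of subtracting the two indices in the sign keeps
  its parity and avoids truncated subtraction.
\<close>

fun run_poly :: "nat \<Rightarrow> real poly" where
  "run_poly 0 = 1"
| "run_poly (Suc m) =
    pCons 0 (\<Sum>j\<le>m. monom ((-1) ^ (m + j) * real (m choose j) / fact (Suc j)) j)"

declare run_poly.simps(2) [simp del]

lemma coeff_run_poly_Suc:
  "coeff (run_poly (Suc m)) (Suc j) = (-1) ^ (m + j) * real (m choose j) / fact (Suc j)"
  by (auto simp: run_poly.simps(2) coeff_sum)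

lemma coeff_run_poly_0: "coeff (run_poly m) 0 = (if m = 0 then 1 else 0)"
  by (cases m) (auto simp: run_poly.simps(2))

text \<open>
  On coefficients this is the recurrence of Pascal's triangle. It also follows from the generating
  function \<open>exp (X * t / (1 + t))\<close> of these polynomials, whose derivative in \<open>X\<close> is itself times
  \<open>t / (1 + t)\<close>.
\<close>

lemma pderiv_run_poly_Suc:
  "pderiv (run_poly (Suc m)) = run_poly m - pderiv (run_poly m)"
proof (rule poly_eqI)
  fix j
  show "coeff (pderiv (run_poly (Suc m))) j = coeff (run_poly m - pderiv (run_poly m)) j"
  proof (cases m)
    case 0
    then show ?thesis by (cases j) (auto simp: coeff_pderiv coeff_run_poly_Suc)
  next
    case (Suc k)
    have d: "coeff (pderiv (run_poly (Suc l))) i = (-1) ^ (l + i) * real (l choose i) / fact i" for l i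
      by (simp add: coeff_pderiv coeff_run_poly_Suc fact_Suc del: of_nat_Suc)
    show ?thesis
    proof (cases j)
      case 0
      with Suc show ?thesis by (simp add: d coeff_run_poly_0)
    next
      case (Suc i)
      with \<open>m = Suc k\<close> show ?thesis
        by (simp add: d coeff_run_poly_Suc ring_distribs add_divide_distrib
            del: fact_Suc)
    qed
  qed
qed

section \<open>Smirnov words with prescribed multiplicities\<close>

definition smirnov_words :: "'a multiset \<Rightarrow> 'a list set" where
  "smirnov_words M = {xs \<in> permutations_of_multiset M. distinct_adj xs}"

definition smirnov_words_from :: "'a \<Rightarrow> 'a multiset \<Rightarrow> 'a list set" where
  "smirnov_words_from a M = {xs \<in> smirnov_words M. xs \<noteq> [] \<and> hd xs = a}"

lemma finite_smirnov_words [simp]: "finite (smirnov_words M)"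
  by (simp add: smirnov_words_def)

lemma finite_smirnov_words_from [simp]: "finite (smirnov_words_from a M)"
  by (simp add: smirnov_words_from_def)

lemma smirnov_words_from_absent:
  assumes "a \<notin># M"
  shows "smirnov_words_from a M = {}"
  using assms
  by (force simp: smirnov_words_from_def smirnov_words_def permutations_of_multiset_def)

text \<open>
  Deleting the first letter \<open>a\<close> leaves an arbitrary Smirnov word that does not start with \<open>a\<close>.
\<close>

lemma card_smirnov_words_from:
  assumes "a \<in># M"
  shows "real (card (smirnov_words_from a M)) =
    real (card (smirnov_words (M - {#a#}))) - real (card (smirnov_words_from a (M - {#a#})))"
proof -
  let ?N = "M - {#a#}"
  have "smirnov_words_from a M = (#) a ` (smirnov_words ?N - smirnov_words_from a ?N)"
  proof (intro equalityI subsetI)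
    fix xs assume xs: "xs \<in> smirnov_words_from a M"
    then obtain ys where ys: "xs = a # ys"
      by (cases xs) (auto simp: smirnov_words_from_def)
    with xs show "xs \<in> (#) a ` (smirnov_words ?N - smirnov_words_from a ?N)"
      by (auto simp: smirnov_words_from_def smirnov_words_def permutations_of_multiset_def
          distinct_adj_Cons)
  next
    fix xs assume "xs \<in> (#) a ` (smirnov_words ?N - smirnov_words_from a ?N)"
    with insert_DiffM[OF assms] show "xs \<in> smirnov_words_from a M"
      by (auto simp: smirnov_words_from_def smirnov_words_def permutations_of_multiset_def
          distinct_adj_Cons)
  qed
  then have "card (smirnov_words_from a M) = card (smirnov_words ?N - smirnov_words_from a ?N)"
    by (simp add: card_image)
  also have "\<dots> = card (smirnov_words ?N) - card (smirnov_words_from a ?N)"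
    by (rule card_Diff_subset) (auto simp: smirnov_words_from_def)
  finally show ?thesis
    by (simp add: of_nat_diff card_mono smirnov_words_from_def)
qed

lemma card_smirnov_words_by_first_letter:
  assumes "M \<noteq> {#}"
  shows "card (smirnov_words M) = (\<Sum>a\<in>set_mset M. card (smirnov_words_from a M))"
proof -
  have "smirnov_words M = (\<Union>a\<in>set_mset M. smirnov_words_from a M)"
  proof (intro equalityI subsetI)
    fix xs assume xs: "xs \<in> smirnov_words M"
    then have M: "M = mset xs"
      by (simp add: smirnov_words_def permutations_of_multiset_def)
    with assms have "xs \<noteq> []" by simp
    moreover from this have "hd xs \<in># M" by (simp add: M)
    ultimately show "xs \<in> (\<Union>a\<in>set_mset M. smirnov_words_from a M)"
      using xs by (simp add: smirnov_words_from_def)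
  qed (auto simp: smirnov_words_from_def)
  then have "card (smirnov_words M) = card (\<Union>a\<in>set_mset M. smirnov_words_from a M)"
    by (rule arg_cong)
  also have "\<dots> = (\<Sum>a\<in>set_mset M. card (smirnov_words_from a M))"
    by (rule card_UN_disjoint) (auto simp: smirnov_words_from_def)
  finally show ?thesis .
qed

text \<open>
  The index set may be larger than the support of the multiset, since absent letters contribute
  the factor \<open>run_poly 0 = 1\<close>. It can thus stay fixed while letters are removed one by one.
\<close>

definition word_poly :: "'a set \<Rightarrow> 'a multiset \<Rightarrow> real poly" where
  "word_poly A M = (\<Prod>a\<in>A. run_poly (count M a))"

text \<open>
  Both equations are proved together by induction on the length. The words starting with \<open>a\<close>
  reduce to both kinds of count for the shorter multiset without one \<open>a\<close>, combined exactly as in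
  \<open>pderiv_run_poly_Suc\<close>. The count of all words is then the sum over the first letter, which the
  product rule turns into the functional of a derivative.
\<close>

theorem card_smirnov_words:
  assumes "finite A" "set_mset M \<subseteq> A"
  shows "real (card (smirnov_words M)) = factorial_functional (word_poly A M)"
    and "a \<in> A \<Longrightarrow> real (card (smirnov_words_from a M)) =
      factorial_functional (pderiv (run_poly (count M a)) * word_poly (A - {a}) M)"
proof -
  have "real (card (smirnov_words M)) = factorial_functional (word_poly A M) \<and>
    (\<forall>a\<in>A. real (card (smirnov_words_from a M)) =
      factorial_functional (pderiv (run_poly (count M a)) * word_poly (A - {a}) M))"
    using assms(2)
  proof (induction M rule: measure_induct_rule[where f = size])
    case (less M)
    have from_letter: "real (card (smirnov_words_from a M)) =
      factorial_functional (pderiv (run_poly (count M a)) * word_poly (A - {a}) M)"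
      if "a \<in> A" for a
    proof (cases "a \<in># M")
      case False
      then have "smirnov_words_from a M = {}"
        by (rule smirnov_words_from_absent)
      with False show ?thesis
        by (simp add: not_in_iff factorial_functional_def)
    next
      case True
      define N where "N = M - {#a#}"
      have M: "M = add_mset a N" using True by (simp add: N_def)
      have rest: "word_poly (A - {a}) M = word_poly (A - {a}) N"
        unfolding word_poly_def M by (rule prod.cong) auto
      have split: "word_poly A N = run_poly (count N a) * word_poly (A - {a}) N"
        using assms(1) \<open>a \<in> A\<close> by (simp add: word_poly_def prod.remove)
      have "real (card (smirnov_words N)) = factorial_functional (word_poly A N)"
        "real (card (smirnov_words_from a N)) =
          factorial_functional (pderiv (run_poly (count N a)) * word_poly (A - {a}) N)"
        using less.IH[of N] less.prems \<open>a \<in> A\<close> by (auto simp: M)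
      then have "real (card (smirnov_words_from a M)) =
        factorial_functional (word_poly A N
          - pderiv (run_poly (count N a)) * word_poly (A - {a}) N)"
        using card_smirnov_words_from[OF True]
        by (simp add: N_def[symmetric] factorial_functional_diff)
      also have "word_poly A N - pderiv (run_poly (count N a)) * word_poly (A - {a}) N
        = pderiv (run_poly (count M a)) * word_poly (A - {a}) M"
        unfolding split rest by (simp add: M pderiv_run_poly_Suc left_diff_distrib)
      finally show ?thesis .
    qed
    have "real (card (smirnov_words M)) = factorial_functional (word_poly A M)"
    proof (cases "M = {#}")
      case True
      then have "smirnov_words M = {[]}"
        by (auto simp: smirnov_words_def)
      with True show ?thesis
        by (simp add: word_poly_def factorial_functional_def)
    next
      case False
      have "card (smirnov_words M) = (\<Sum>a\<in>A. card (smirnov_words_from a M))"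
        unfolding card_smirnov_words_by_first_letter[OF False]
      proof (rule sum.mono_neutral_left)
        show "\<forall>a\<in>A - set_mset M. card (smirnov_words_from a M) = 0"
          by (simp add: smirnov_words_from_absent)
      qed (use assms(1) less.prems in auto)
      then have "real (card (smirnov_words M)) = factorial_functional
        (\<Sum>a\<in>A. pderiv (run_poly (count M a)) * word_poly (A - {a}) M)"
        by (simp add: from_letter factorial_functional_sum)
      also have "(\<Sum>a\<in>A. pderiv (run_poly (count M a)) * word_poly (A - {a}) M)
        = pderiv (word_poly A M)"
        by (simp add: word_poly_def pderiv_prod mult.commute)
      \<comment> \<open>A letter that occurs makes the constant term vanish, so integration by parts leaves no
        boundary term.\<close>
      also have "factorial_functional \<dots> = factorial_functional (word_poly A M)"
      proof -
        obtain a where "a \<in># M" using False by blast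
        with less.prems have "\<exists>a\<in>A. count M a \<noteq> 0" by auto
        moreover have "coeff (word_poly A M) 0 = (\<Prod>a\<in>A. coeff (run_poly (count M a)) 0)"
          by (simp add: word_poly_def poly_prod flip: poly_0_coeff_0)
        ultimately have "coeff (word_poly A M) 0 = 0"
          using assms(1) by (simp add: coeff_run_poly_0)
        then show ?thesis by (simp add: factorial_functional_pderiv)
      qed
      finally show ?thesis .
    qed
    with from_letter show ?case by blast
  qed
  then show "real (card (smirnov_words M)) = factorial_functional (word_poly A M)"
    "a \<in> A \<Longrightarrow> real (card (smirnov_words_from a M)) =
      factorial_functional (pderiv (run_poly (count M a)) * word_poly (A - {a}) M)"
    by blast+
qed

section \<open>Four copies of each letter\<close>

lemma alpha0_eq_factorial_functional:
  "real (alpha0 n) = factorial_functional (run_poly 4 ^ n)"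
proof -
  have "set_mset (four_copies n) \<subseteq> {1..n}"
    by (auto simp: count_four_copies simp flip: count_greater_zero_iff split: if_splits)
  then have "real (card (smirnov_words (four_copies n)))
      = factorial_functional (word_poly {1..n} (four_copies n))"
    by (intro card_smirnov_words) auto
  then show ?thesis
    by (simp add: alpha0_def smirnov_words_def word_poly_def count_four_copies)
qed

text \<open>
  The coefficient \<open>3 / 2\<close> of \<open>X ^ 2\<close> is split into \<open>1 + 1 / 2\<close>: two of the three compositions of
  four into two parts are \<open>1 + 3\<close> and \<open>3 + 1\<close>, the third is \<open>2 + 2\<close>.
\<close>

lemma run_poly_4:
  "run_poly 4 = monom (1 / fact 4) 4 + monom (- 1 / fact 2) 3 + monom 1 2
    + monom (1 / fact 2) 2 + monom (-1) 1"
proof -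
  have "run_poly 4 = run_poly (Suc 3)" by simp
  also have "\<dots> = monom (1 / fact 4) 4 + monom (- 1 / fact 2) 3 + monom 1 2
    + monom (1 / fact 2) 2 + monom (-1) 1"
    by (simp add: run_poly.simps(2) eval_nat_numeral monom_Suc monom_0)
  finally show ?thesis .
qed

lemma multinomial_theorem5:
  fixes a b c d e :: "'a::comm_ring_1"
  shows "(a + b + c + d + e) ^ n = (\<Sum>(s, t, u, v, w) \<in> weak_compositions5 n.
    of_nat ((n choose s) * (n - s choose t) * (n - s - t choose u) * (n - s - t - u choose v))
      * (a ^ s * b ^ t * c ^ u * d ^ v * e ^ w))"
proof -
  have "(a + b + c + d + e) ^ n = (a + (b + (c + (d + e)))) ^ n"
    by (simp add: add.assoc)
  also have "\<dots> = (\<Sum>s\<le>n. \<Sum>t\<le>n - s. \<Sum>u\<le>n - s - t. \<Sum>v\<le>n - s - t - u.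
    of_nat ((n choose s) * (n - s choose t) * (n - s - t choose u) * (n - s - t - u choose v))
      * (a ^ s * b ^ t * c ^ u * d ^ v * e ^ (n - s - t - u - v)))"
    by (simp only: binomial_ring sum_distrib_left sum_distrib_right of_nat_mult mult_ac)
  also have "\<dots> = (\<Sum>(s, t, u, v)\<in>(SIGMA s:{..n}. SIGMA t:{..n - s}. SIGMA u:{..n - s - t}.
      {..n - s - t - u}).
    of_nat ((n choose s) * (n - s choose t) * (n - s - t choose u) * (n - s - t - u choose v))
      * (a ^ s * b ^ t * c ^ u * d ^ v * e ^ (n - s - t - u - v)))"
    by (simp add: sum.Sigma split_def)
  also have "\<dots> = (\<Sum>(s, t, u, v, w) \<in> weak_compositions5 n.
    of_nat ((n choose s) * (n - s choose t) * (n - s - t choose u) * (n - s - t - u choose v))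
      * (a ^ s * b ^ t * c ^ u * d ^ v * e ^ w))"
    by (rule sum.reindex_bij_witness[where
          i = "\<lambda>(s, t, u, v, w). (s, t, u, v)" and
          j = "\<lambda>(s, t, u, v). (s, t, u, v, n - s - t - u - v)"])
      (auto simp: weak_compositions5_def)
  finally show ?thesis .
qed

lemma multinomial5_eq_binomials:
  assumes "s + t + u + v + w = n"
  shows "real ((n choose s) * (n - s choose t) * (n - s - t choose u) * (n - s - t - u choose v))
    = multinomial5 n s t u v w"
proof -
  have n: "n = s + (t + (u + (v + w)))" using assms by simp
  show ?thesis
    by (simp add: n multinomial5_def binomial_fact)
qed

theorem corollary3:
  fixes n :: nat
  assumes "n \<ge> 1"
  shows "real (alpha0 n) =
    (\<Sum>(s, t, u, v, w) \<in> weak_compositions5 n.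
      (-1) ^ (t + w) * multinomial5 n s t u v w *
      (fact (4 * s + 3 * t + 2 * u + 2 * v + w) /
        (fact 4 ^ s * fact 2 ^ t * fact 2 ^ v)))"
proof -
  have "real (alpha0 n) = (\<Sum>(s, t, u, v, w) \<in> weak_compositions5 n.
    factorial_functional (of_nat ((n choose s) * (n - s choose t) * (n - s - t choose u)
        * (n - s - t - u choose v))
      * (monom (1 / fact 4) 4 ^ s * monom (- 1 / fact 2) 3 ^ t * monom 1 2 ^ u
        * monom (1 / fact 2) 2 ^ v * monom (-1) 1 ^ w)))"
    unfolding alpha0_eq_factorial_functional run_poly_4 multinomial_theorem5
      factorial_functional_sum by (simp only: split_def)
  also have "\<dots> = (\<Sum>(s, t, u, v, w) \<in> weak_compositions5 n.
      (-1) ^ (t + w) * multinomial5 n s t u v w *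
      (fact (4 * s + 3 * t + 2 * u + 2 * v + w) /
        (fact 4 ^ s * fact 2 ^ t * fact 2 ^ v)))"
  proof (intro sum.cong refl, clarify)
    fix s t u v w assume "(s, t, u, v, w) \<in> weak_compositions5 n"
    then have "s + t + u + v + w = n" by (simp add: weak_compositions5_def)
    note coefficient = multinomial5_eq_binomials[OF this]
    have "monom (1 / fact 4) 4 ^ s * monom (- 1 / fact 2) 3 ^ t * monom 1 2 ^ u
        * monom (1 / fact 2) 2 ^ v * monom (-1) 1 ^ w
      = monom ((-1) ^ (t + w) / (fact 4 ^ s * fact 2 ^ t * fact 2 ^ v) :: real)
          (4 * s + 3 * t + 2 * u + 2 * v + w)"
      by (simp only: monom_power mult_monom power_divide power_one) (simp add: power_add)
    then show "factorial_functional (of_nat ((n choose s) * (n - s choose t)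
        * (n - s - t choose u) * (n - s - t - u choose v))
      * (monom (1 / fact 4) 4 ^ s * monom (- 1 / fact 2) 3 ^ t * monom 1 2 ^ u
        * monom (1 / fact 2) 2 ^ v * monom (-1) 1 ^ w))
      = (-1) ^ (t + w) * multinomial5 n s t u v w *
      (fact (4 * s + 3 * t + 2 * u + 2 * v + w) /
        (fact 4 ^ s * fact 2 ^ t * fact 2 ^ v))"
      unfolding of_nat_poly coefficient[symmetric]
      by (simp only: mult_pCons_left)
        (simp add: factorial_functional_smult factorial_functional_monom)
  qed
  finally show ?thesis .
qed

end
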